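(* Let $G$ be a finite group of order $n>1$, and let $q$ and $p$ be the smallest and the largest prime divisors of $n$, respectively. Suppose that $$\psi(G)\geq \frac{1}{q}\,n\,\varphi(n).$$ Then either $G$ has a normal cyclic Sylow $p$-subgroup, or $G$ is solvable and has a cyclic maximal subgroup of index either $p$ or $p+1$.
   Context: For a finite group $G$, $\psi(G)=\sum_{g\in G} o(g)$ denotes the sum of the orders of all elements of $G$. $\varphi$ is Euler's totient function. *)

theory Defs
  imports "HOL-Algebra.Algebra" "HOL-Number_Theory.Number_Theory"
begin

definition psi :: "('a, 'b) monoid_scheme \<Rightarrow> nat" where
  "psi G = (\<Sum>x\<in>carrier G. group.ord G x)"

definition sylow_subgroup :: "('a, 'b) monoid_scheme \<Rightarrow> nat \<Rightarrow> 'a set \<Rightarrow> bool" where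
  "sylow_subgroup G p P \<longleftrightarrow> subgroup P G \<and> card P = p ^ multiplicity p (order G)"

definition maximal_subgroup :: "('a, 'b) monoid_scheme \<Rightarrow> 'a set \<Rightarrow> bool" where
  "maximal_subgroup G M \<longleftrightarrow> subgroup M G \<and> M \<noteq> carrier G \<and>
     (\<forall>H. subgroup H G \<and> M \<subseteq> H \<longrightarrow> H = M \<or> H = carrier G)"

end

theory Submission
  imports Defs
begin

text \<open>Since \<open>\<phi>(n) / n \<ge> (q - 1) / p\<close>, an element \<open>x\<close> whose order exceeds the average order
  generates a cyclic subgroup \<open>A\<close> of index \<open>m < 2 p\<close>. If \<open>p\<close> divides \<open>m\<close>, then \<open>m = p\<close> and \<open>A\<close> is
  maximal. Otherwise \<open>A\<close> contains a Sylow \<open>p\<close>-subgroup \<open>P\<close>, and counting the fixed points of \<open>P\<close> on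
  the cosets of \<open>A\<close> shows that \<open>P\<close> is normal, or that \<open>m = p + 1\<close> and \<open>A\<close> is the normalizer
  of \<open>P\<close>; in the latter case the same count in a subgroup between \<open>A\<close> and \<open>G\<close> gives maximality of
  \<open>A\<close>. Solvability is clear if \<open>A\<close> is normal; if not, \<open>A\<close> is a Frobenius complement modulo the center
  of \<open>G\<close>, and since its index is \<open>p\<close> or \<open>p + 1\<close> the Frobenius kernel is abelian for elementary
  reasons.\<close>

no_notation (ASCII) subset_mset (infix \<open><#\<close> 50)
hide_const (open) Divisibility.prime

subsection \<open>Elements of large order\<close>

text \<open>The factor for \<open>r\<close> is \<open>(r - 1) / r\<close>, so the product
  telescopes.\<close>

lemma prod_one_minus_inverse_interval:
  fixes q p :: nat
  assumes "2 \<le> q" "q \<le> p"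
  shows "(\<Prod>r=q..p. 1 - 1 / real r) = (real q - 1) / real p"
  using assms(2)
proof (induction p rule: dec_induct)
  case base
  then show ?case using assms(1) by (simp add: field_simps)
next
  case (step k)
  then show ?case using assms(1) by (simp add: prod.nat_ivl_Suc' field_simps)
qed

text \<open>\<open>totient n / n\<close> is the product of \<open>1 - 1 / r\<close> over the prime
  divisors \<open>r\<close> of \<open>n\<close>. These all lie in \<open>{q..p}\<close>, and letting
  \<open>r\<close> run through the whole interval can only make the product smaller, down to the
  telescoping one.\<close>

lemma totient_ge:
  fixes n q p :: nat
  assumes "n > 1" and q: "q = Min (prime_factors n)" and p: "p = Max (prime_factors n)"
  shows "real n * (real q - 1) \<le> real p * real (totient n)"
proof -
  have ne: "prime_factors n \<noteq> {}"
    using assms(1) by (auto simp: prime_factorization_empty_iff)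
  have qin: "q \<in> prime_factors n" and pin: "p \<in> prime_factors n"
    using ne q p by (auto intro!: Min_in Max_in simp del: in_prime_factors_iff)
  have sub: "prime_factors n \<subseteq> {q..p}"
    using q p by auto
  have q2: "2 \<le> q" and p0: "p > 0"
    using qin pin in_prime_factors_imp_prime prime_ge_2_nat prime_gt_0_nat by blast+
  have "q \<le> p" using sub qin by auto
  then have "(real q - 1) / real p = (\<Prod>r=q..p. 1 - 1 / real r)"
    using prod_one_minus_inverse_interval q2 by simp
  also have "\<dots> = (\<Prod>r\<in>{q..p} - prime_factors n. 1 - 1 / real r) * (\<Prod>r\<in>prime_factors n. 1 - 1 / real r)"
    using sub by (intro prod.subset_diff) auto
  also have "\<dots> \<le> 1 * (\<Prod>r\<in>prime_factors n. 1 - 1 / real r)"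
    using q2 sub by (intro mult_right_mono prod_le_1 prod_nonneg) (auto simp: divide_le_eq_1)
  also have "real n * \<dots> = real (totient n)"
    by (simp add: totient_formula2)
  finally have "real n * ((real q - 1) / real p) \<le> real (totient n)"
    using mult_left_mono[of "(real q - 1) / real p" _ "real n"]
    by (simp add: totient_formula2 mult_left_mono)
  then show ?thesis using p0 by (simp add: field_simps)
qed

text \<open>Strictness comes from the identity: if no order exceeded \<open>c\<close>, the bound on
  the sum would force every order to equal \<open>c\<close>, hence to equal 1, the order of the
  identity.\<close>

lemma (in group) exists_ord_gt_average:
  fixes c :: real
  assumes fin: "finite (carrier G)" and "order G > 1" and psi: "real (psi G) \<ge> real (order G) * c"
  shows "\<exists>x\<in>carrier G. real (ord x) > c"
proof (rule ccontr)
  assume "\<not> ?thesis"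
  then have le: "real (ord x) \<le> c" if "x \<in> carrier G" for x
    using that by fastforce
  have "(\<Sum>x\<in>carrier G. real (ord x)) = (\<Sum>x\<in>carrier G. c)"
    using psi sum_mono[of "carrier G" "\<lambda>x. real (ord x)" "\<lambda>_. c"] le
    by (intro antisym) (auto simp: psi_def order_def)
  then have eq: "real (ord x) = c" if "x \<in> carrier G" for x
    using sum_mono_inv[of "\<lambda>x. real (ord x)" "carrier G" "\<lambda>_. c"] le that fin by blast
  have "ord x = 1" if "x \<in> carrier G" for x
    using eq[OF that] eq[OF one_closed] ord_id by simp
  then have "carrier G = {\<one>}"
    using ord_eq_1 by auto
  then show False using \<open>order G > 1\<close> by (simp add: order_def)
qed

text \<open>An element of order above \<open>totient n / q\<close>, where \<open>n\<close> is the
  group order, generates a subgroup of index below \<open>n * q / totient n\<close>. By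
  \<open>totient_ge\<close> this is at most \<open>p * q / (q - 1)\<close>, and
  \<open>q \<le> 2 * (q - 1)\<close> because \<open>q \<ge> 2\<close>.\<close>

lemma (in group) exists_ord_index_less:
  assumes fin: "finite (carrier G)" and n1: "order G > 1"
    and q: "q = Min (prime_factors (order G))" and p: "p = Max (prime_factors (order G))"
    and psi: "real (psi G) \<ge> real (order G) * real (totient (order G)) / real q"
  shows "\<exists>x\<in>carrier G. order G < 2 * p * ord x"
proof -
  have "q \<in> prime_factors (order G)"
    unfolding q using n1 by (intro Min_in) (auto simp: prime_factorization_empty_iff)
  then have q2: "2 \<le> q" using in_prime_factors_imp_prime prime_ge_2_nat by blast
  obtain x where x: "x \<in> carrier G" "real (ord x) > real (totient (order G)) / real q"
    using exists_ord_gt_average[OF fin n1, of "real (totient (order G)) / real q"] psi by auto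
  have "p > 0"
    using totient_ge[OF n1 q p] n1 q2 by (cases "p = 0") (auto simp: mult_le_0_iff)
  have "real (order G) * real q \<le> 2 * (real (order G) * (real q - 1))"
    using q2 mult_left_mono[of 2 "real q" "real (order G)"] by (simp add: algebra_simps)
  also have "\<dots> \<le> 2 * (real p * real (totient (order G)))"
    using totient_ge[OF n1 q p] by simp
  also have "\<dots> < 2 * (real p * (real (ord x) * real q))"
    using x q2 \<open>p > 0\<close> by (simp add: field_simps)
  finally have "real (order G) < real (2 * p * ord x)"
    using q2 by (simp add: field_simps)
  then show ?thesis using x(1) of_nat_less_iff by blast
qed

subsection \<open>Counting fixed cosets\<close>

text \<open>The orbits partition \<open>E\<close>, and those that are not fixed points contribute
  multiples of \<open>d\<close>. The modulus is kept general because it is later both a prime and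
  the order of a subgroup.\<close>

lemma (in group_action) cong_card_fixed_points:
  assumes fin: "finite E" "finite (carrier G)"
    and orb: "\<And>x. x \<in> E \<Longrightarrow> orbit G \<phi> x = {x} \<or> d dvd card (orbit G \<phi> x)"
  shows "[card E = card {x \<in> E. orbit G \<phi> x = {x}}] (mod d)"
proof -
  let ?F = "{x \<in> E. orbit G \<phi> x = {x}}"
  \<comment> \<open>The singletons of fixed points are excluded explicitly: for \<open>d = 1\<close>
    they too satisfy \<open>d dvd card C\<close>, and the union below has to be disjoint.\<close>
  let ?O = "{C \<in> orbits G E \<phi>. d dvd card C \<and> (\<forall>x\<in>?F. C \<noteq> {x})}"
  have finO: "finite (orbits G E \<phi>)"
    using fin(1) by (simp add: orbits_def)
  have "orbits G E \<phi> = (\<lambda>x. {x}) ` ?F \<union> ?O"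
    using orb by (fastforce simp: orbits_def)
  moreover have "card E = sum card (orbits G E \<phi>)"
    using disjoint_sum[OF fin(1), of "\<lambda>_. 1::nat"] by simp
  ultimately have "card E = sum card ((\<lambda>x. {x}) ` ?F \<union> ?O)" by simp
  also have "\<dots> = sum card ((\<lambda>x. {x}) ` ?F) + sum card ?O"
    using fin(1) finO by (intro sum.union_disjoint) auto
  also have "sum card ((\<lambda>x. {x}) ` ?F) = card ?F"
    by (subst sum.reindex) (auto simp: inj_on_def)
  finally have "card E = card ?F + sum card ?O" .
  moreover have "d dvd sum card ?O" by (intro dvd_sum) auto
  ultimately show ?thesis
    by (auto simp: cong_def elim!: dvdE)
qed

text \<open>An action is a homomorphism into \<open>BijGroup E\<close>, whose elements are
  extensional; this explains the restriction to \<open>E\<close>. Bijectivity is automatic, as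
  \<open>f (inv g)\<close> inverts \<open>f g\<close>.\<close>

lemma group_actionI:
  fixes G (structure)
  assumes "group G"
    and closed: "\<And>g x. g \<in> carrier G \<Longrightarrow> x \<in> E \<Longrightarrow> f g x \<in> E"
    and one: "\<And>x. x \<in> E \<Longrightarrow> f \<one>\<^bsub>G\<^esub> x = x"
    and mult: "\<And>g h x. g \<in> carrier G \<Longrightarrow> h \<in> carrier G \<Longrightarrow> x \<in> E \<Longrightarrow> f (g \<otimes>\<^bsub>G\<^esub> h) x = f g (f h x)"
  shows "group_action G E (\<lambda>g. \<lambda>x\<in>E. f g x)"
proof -
  interpret group G by fact
  have inv: "f (inv g) (f g x) = x" "f g (f (inv g) x) = x" if "g \<in> carrier G" "x \<in> E" for g x
    using that mult[of "inv g" g x] mult[of g "inv g" x] one by auto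
  have Bij: "(\<lambda>x\<in>E. f g x) \<in> Bij E" if g: "g \<in> carrier G" for g
  proof -
    have "bij_betw (f g) E E"
      using inv g closed by (intro bij_betwI[where g = "f (inv g)"]) auto
    then show ?thesis by (simp add: Bij_def bij_betw_restrict_eq)
  qed
  have "(\<lambda>g. \<lambda>x\<in>E. f g x) \<in> hom G (BijGroup E)"
  proof (rule homI)
    fix g h assume gh: "g \<in> carrier G" "h \<in> carrier G"
    show "(\<lambda>x\<in>E. f (g \<otimes> h) x) = (\<lambda>x\<in>E. f g x) \<otimes>\<^bsub>BijGroup E\<^esub> (\<lambda>x\<in>E. f h x)"
      using gh Bij closed mult by (simp add: BijGroup_def) (auto simp: compose_def)
  qed (use Bij in \<open>auto simp: BijGroup_def\<close>)
  then show ?thesis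
    by (simp add: group_action_def group_hom_def group_hom_axioms_def group_BijGroup is_group)
qed

lemma (in group) l_coset_eq_iff:
  assumes "subgroup H G" "a \<in> carrier G" "b \<in> carrier G"
  shows "a <# H = b <# H \<longleftrightarrow> inv a \<otimes> b \<in> H"
  by (metis assms group_l_invI is_group l_repr_independence lcos_self subgroup.lcos_module_imp
      subgroup.lcos_module_rev)

text \<open>\<open>H\<close> acts on the left cosets of \<open>A\<close> by left multiplication. The
  set in the hypothesis \<open>d\<close> is the stabilizer of \<open>g <# A\<close>, so the quotient
  there is the length of an orbit.\<close>

lemma (in group) cong_card_fixed_lcosets:
  assumes fin: "finite (carrier G)" and H: "subgroup H G" and A: "subgroup A G"
    and d: "\<And>g. g \<in> carrier G \<Longrightarrow> (\<forall>h\<in>H. inv g \<otimes> h \<otimes> g \<in> A)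
              \<or> d dvd card H div card {h \<in> H. inv g \<otimes> h \<otimes> g \<in> A}"
  shows "[card (lcosets A) =
           card {g <# A | g. g \<in> carrier G \<and> (\<forall>h\<in>H. inv g \<otimes> h \<otimes> g \<in> A)}] (mod d)"
proof -
  define \<phi> where "\<phi> = (\<lambda>h. \<lambda>C\<in>lcosets A. h <# C)"
  have Ac: "A \<subseteq> carrier G" and Hc: "H \<subseteq> carrier G"
    using A H by (simp_all add: subgroup.subset)
  have E: "g <# A \<in> lcosets A" if "g \<in> carrier G" for g
    using that by (auto simp: LCOSETS_def)
  have "group_action (G\<lparr>carrier := H\<rparr>) (lcosets A) \<phi>"
    unfolding \<phi>_def
  proof (rule group_actionI)
    show "group (G\<lparr>carrier := H\<rparr>)" by (rule subgroup_imp_group[OF H])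
  qed (use Hc Ac in \<open>auto simp: LCOSETS_def lcos_m_assoc m_assoc lcos_mult_one l_coset_subset_G subsetD\<close>)
  then interpret act: group_action "G\<lparr>carrier := H\<rparr>" "lcosets A" \<phi> .
  have \<phi>: "\<phi> h (g <# A) = (h \<otimes> g) <# A" if "h \<in> H" "g \<in> carrier G" for h g
    using that Hc Ac E by (auto simp: \<phi>_def lcos_m_assoc)
  have fix_iff: "\<phi> h (g <# A) = g <# A \<longleftrightarrow> inv g \<otimes> h \<otimes> g \<in> A" if "h \<in> H" "g \<in> carrier G" for h g
    using l_coset_eq_iff[OF A, of g "h \<otimes> g"] that Hc by (auto simp: \<phi> m_assoc subsetD)
  have orb_eq: "orbit (G\<lparr>carrier := H\<rparr>) \<phi> (g <# A) = {g <# A} \<longleftrightarrow> (\<forall>h\<in>H. inv g \<otimes> h \<otimes> g \<in> A)"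
    if "g \<in> carrier G" for g
    using that fix_iff subgroup.one_closed[OF H] by (auto simp: orbit_def)
  have "finite (lcosets A)"
    using fin by (auto simp: LCOSETS_def)
  have "[card (lcosets A) = card {C \<in> lcosets A. orbit (G\<lparr>carrier := H\<rparr>) \<phi> C = {C}}] (mod d)"
  proof (rule act.cong_card_fixed_points)
    fix C assume "C \<in> lcosets A"
    then obtain g where g: "g \<in> carrier G" and C: "C = g <# A" by (auto simp: LCOSETS_def)
    have "stabilizer (G\<lparr>carrier := H\<rparr>) \<phi> C = {h \<in> H. inv g \<otimes> h \<otimes> g \<in> A}"
      using fix_iff g C by (auto simp: stabilizer_def)
    then have "card (orbit (G\<lparr>carrier := H\<rparr>) \<phi> C) * card {h \<in> H. inv g \<otimes> h \<otimes> g \<in> A} = card H"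
      using act.orbit_stabilizer_theorem[OF \<open>C \<in> lcosets A\<close>] by (simp add: order_def)
    moreover have "card H > 0"
      using fin Hc subgroup.one_closed[OF H] finite_subset card_gt_0_iff by blast
    ultimately have "card H div card {h \<in> H. inv g \<otimes> h \<otimes> g \<in> A} = card (orbit (G\<lparr>carrier := H\<rparr>) \<phi> C)"
      by (metis mult_0_right nonzero_mult_div_cancel_right not_gr_zero)
    then show "orbit (G\<lparr>carrier := H\<rparr>) \<phi> C = {C} \<or> d dvd card (orbit (G\<lparr>carrier := H\<rparr>) \<phi> C)"
      using d[OF g] orb_eq[OF g] C by auto
  qed (use \<open>finite (lcosets A)\<close> fin Hc in \<open>auto intro: finite_subset\<close>)
  also have "{C \<in> lcosets A. orbit (G\<lparr>carrier := H\<rparr>) \<phi> C = {C}} =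
      {g <# A | g. g \<in> carrier G \<and> (\<forall>h\<in>H. inv g \<otimes> h \<otimes> g \<in> A)}"
    using orb_eq by (auto simp: LCOSETS_def)
  finally show ?thesis .
qed

subsection \<open>Cyclic subgroups of small index\<close>

lemma (in group) card_subgroup_dvd_card_subgroup:
  assumes "subgroup B G" "subgroup H G" "B \<subseteq> H"
  shows "card B dvd card H"
proof -
  interpret H: group "G\<lparr>carrier := H\<rparr>" by (rule subgroup_imp_group[OF assms(2)])
  have "card B dvd order (G\<lparr>carrier := H\<rparr>)"
    using H.lagrange[OF subgroup_incl[OF assms]] by (metis dvd_triv_right)
  then show ?thesis by (simp add: order_def)
qed

section \<open>Conjugation and normalizers\<close>

lemma (in group) conjugate_mult:
  assumes "g \<in> carrier G" "x \<in> carrier G" "y \<in> carrier G"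
  shows "inv g \<otimes> (x \<otimes> y) \<otimes> g = (inv g \<otimes> x \<otimes> g) \<otimes> (inv g \<otimes> y \<otimes> g)"
proof -
  have "(inv g \<otimes> x \<otimes> g) \<otimes> (inv g \<otimes> y \<otimes> g) = inv g \<otimes> x \<otimes> (g \<otimes> inv g) \<otimes> y \<otimes> g"
    using assms by (simp only: m_assoc m_closed inv_closed)
  then show ?thesis using assms by (simp add: m_assoc)
qed

lemma (in group) conjugate_inv:
  assumes "g \<in> carrier G" "x \<in> carrier G"
  shows "inv g \<otimes> inv x \<otimes> g = inv (inv g \<otimes> x \<otimes> g)"
  using assms by (simp add: inv_mult_group m_assoc)

lemma (in group) conjugate_pow:
  assumes "g \<in> carrier G" "x \<in> carrier G"
  shows "(inv g \<otimes> x \<otimes> g) [^] (n::nat) = inv g \<otimes> x [^] n \<otimes> g"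
  using assms by (induction n) (simp_all add: conjugate_mult)

lemma (in group) inj_on_conjugate:
  assumes "g \<in> carrier G"
  shows "inj_on (\<lambda>x. inv g \<otimes> x \<otimes> g) (carrier G)"
  using assms by (auto simp: inj_on_def)

text \<open>This is the intersection of \<open>H\<close> with a conjugate of \<open>A\<close>, that
  is, the stabilizer in \<open>H\<close> of the coset \<open>g <# A\<close>.\<close>

lemma (in group) subgroup_conjugate_preimage:
  assumes "subgroup H G" "subgroup A G" "g \<in> carrier G"
  shows "subgroup {h \<in> H. inv g \<otimes> h \<otimes> g \<in> A} G"
proof -
  interpret H: subgroup H G by fact
  interpret A: subgroup A G by fact
  show ?thesis
    using assms(3) by unfold_locales (auto simp: conjugate_mult conjugate_inv)
qed

text \<open>The condition only asks that a conjugate of \<open>P\<close> be contained in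
  \<open>P\<close>. Finiteness turns the inclusion into equality, which gives closure under
  inverses.\<close>

lemma (in group) finite_subgroup_normalizer:
  assumes "finite P" "P \<subseteq> carrier G"
  shows "subgroup {g \<in> carrier G. \<forall>y\<in>P. inv g \<otimes> y \<otimes> g \<in> P} G"
proof
  fix g h assume gh: "g \<in> {g \<in> carrier G. \<forall>y\<in>P. inv g \<otimes> y \<otimes> g \<in> P}"
    "h \<in> {g \<in> carrier G. \<forall>y\<in>P. inv g \<otimes> y \<otimes> g \<in> P}"
  have "inv (g \<otimes> h) \<otimes> y \<otimes> (g \<otimes> h) = inv h \<otimes> (inv g \<otimes> y \<otimes> g) \<otimes> h" if "y \<in> P" for y
    using that gh assms by (auto simp: inv_mult_group m_assoc subsetD)
  then show "g \<otimes> h \<in> {g \<in> carrier G. \<forall>y\<in>P. inv g \<otimes> y \<otimes> g \<in> P}"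
    using gh by auto
next
  fix g assume g: "g \<in> {g \<in> carrier G. \<forall>y\<in>P. inv g \<otimes> y \<otimes> g \<in> P}"
  then have "(\<lambda>y. inv g \<otimes> y \<otimes> g) ` P = P"
    using assms inj_on_subset[OF inj_on_conjugate] by (intro endo_inj_surj) auto
  then have "\<exists>z\<in>P. y = inv g \<otimes> z \<otimes> g" if "y \<in> P" for y using that by blast
  moreover have "inv (inv g) \<otimes> (inv g \<otimes> z \<otimes> g) \<otimes> inv g = z" if "z \<in> P" for z
  proof -
    have "g \<otimes> (inv g \<otimes> z \<otimes> g) \<otimes> inv g = (g \<otimes> inv g) \<otimes> z \<otimes> (g \<otimes> inv g)"
      using that g assms(2) by (auto simp only: m_assoc m_closed inv_closed subsetD mem_Collect_eq)
    then show ?thesis using that g assms(2) by auto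
  qed
  ultimately have "\<forall>y\<in>P. inv (inv g) \<otimes> y \<otimes> inv g \<in> P" by metis
  then show "inv g \<in> {g \<in> carrier G. \<forall>y\<in>P. inv g \<otimes> y \<otimes> g \<in> P}"
    using g by auto
qed (use assms in auto)

section \<open>Subgroups of a finite cyclic group\<close>

lemma (in group) cyclic_group_generate:
  "x \<in> carrier G \<Longrightarrow> cyclic_group (G\<lparr>carrier := generate G {x}\<rparr>)"
  using cyclic_group_generated[of x] by (simp add: subgroup_generated_def)

text \<open>A power \<open>x [^] j\<close> solves the equation iff \<open>ord x div d\<close>
  divides \<open>j\<close>. Both descriptions of this subgroup are used: the equation is preserved
  by conjugation, and the generator shows that the subgroup is cyclic.\<close>

lemma (in group) generate_roots_of_one:
  assumes fin: "finite (carrier G)" and x: "x \<in> carrier G" and d: "d dvd ord x"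
  shows "{y \<in> generate G {x}. y [^] d = \<one>} = generate G {x [^] (ord x div d)}"
proof -
  have pos: "ord x > 0" using ord_ge_1[OF fin x] by simp
  then obtain k where k: "ord x = d * k" "k > 0" "d > 0" using d by auto
  have "\<exists>i. x [^] j = (x [^] k) [^] (i::nat)" if "(x [^] j) [^] d = \<one>" for j :: nat
  proof -
    have "d * k dvd j * d" using that x k by (simp add: nat_pow_pow pow_eq_id)
    then have "k dvd j" using k by (simp add: mult.commute)
    then show ?thesis using x by (auto simp: nat_pow_pow elim!: dvdE)
  qed
  moreover have "((x [^] k) [^] i) [^] d = \<one>" for i :: nat
    using x k by (simp add: nat_pow_pow pow_eq_id)
  ultimately have "{y. \<exists>j::nat. y = x [^] j \<and> y [^] d = \<one>} = {y. \<exists>i::nat. y = (x [^] k) [^] i}"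
    using nat_pow_pow[OF x, of k] by blast
  then show ?thesis
    using x k by (simp add: generate_pow_on_finite_carrier[OF fin] Collect_conj_eq[symmetric])
qed

lemma (in group) card_generate_roots_of_one:
  assumes fin: "finite (carrier G)" and x: "x \<in> carrier G" and d: "d dvd ord x"
  shows "card {y \<in> generate G {x}. y [^] d = \<one>} = d"
proof -
  have pos: "ord x > 0" using ord_ge_1[OF fin x] by simp
  then obtain k where k: "ord x = d * k" "k > 0" "d > 0" using d by auto
  then have "ord (x [^] k) = d" using x ord_pow[of x k] by simp
  then show ?thesis
    using generate_roots_of_one[OF assms] k x generate_pow_card[of "x [^] k"] by simp
qed

text \<open>The subgroup \<open>P\<close> acts by translation on the \<open>m < 2 * p\<close> cosets of \<open>A = generate G {x}\<close>.
  As \<open>P\<close> is the only subgroup of its order in \<open>A\<close>, the fixed points are the cosets contained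
  in the normalizer of \<open>P\<close>, and there is at most one orbit of length \<open>p\<close>.\<close>

lemma (in group) cyclic_subgroup_small_index:
  assumes fin: "finite (carrier G)" and p: "prime p" and x: "x \<in> carrier G"
    and m: "order G = m * ord x" "m < 2 * p" "\<not> p dvd m"
    and P_def: "P = {y \<in> generate G {x}. y [^] (p ^ multiplicity p (ord x)) = \<one>}"
  shows "(\<forall>g\<in>carrier G. \<forall>y\<in>P. inv g \<otimes> y \<otimes> g \<in> P) \<or>
    m = p + 1 \<and> (\<forall>g\<in>carrier G. (\<forall>y\<in>P. inv g \<otimes> y \<otimes> g \<in> P) \<longrightarrow> g \<in> generate G {x})"
proof -
  \<comment> \<open>\<open>e\<close> is the \<open>p\<close>-part of \<open>card A\<close>, so
    \<open>P\<close> is the Sylow \<open>p\<close>-subgroup of \<open>A\<close>; \<open>N\<close> is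
    its normalizer in \<open>G\<close>.\<close>
  define A where "A = generate G {x}"
  define e where "e = p ^ multiplicity p (ord x)"
  define N where "N = {g \<in> carrier G. \<forall>y\<in>P. inv g \<otimes> y \<otimes> g \<in> P}"
  have e: "e dvd ord x" unfolding e_def by (rule multiplicity_dvd)
  have pos: "ord x > 0" using ord_ge_1[OF fin x] by simp
  have A: "subgroup A G" unfolding A_def using x by (intro generate_is_subgroup) auto
  have Ac: "A \<subseteq> carrier G" using A by (rule subgroup.subset)
  have cardA: "card A = ord x" unfolding A_def using x generate_pow_card by simp
  have P: "subgroup P G"
    unfolding P_def generate_roots_of_one[OF fin x e[unfolded e_def]]
    using x by (intro generate_is_subgroup) auto
  have PA: "P \<subseteq> A" by (auto simp: P_def A_def)
  have cardP: "card P = e"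
    unfolding P_def e_def using card_generate_roots_of_one[OF fin x] e[unfolded e_def] by simp
  have N: "subgroup N G"
    unfolding N_def using finite_subset[OF subset_trans[OF PA Ac] fin] PA Ac
    by (intro finite_subgroup_normalizer) auto
  have AN: "A \<subseteq> N"
  proof
    fix a assume a: "a \<in> A"
    have "inv a \<otimes> y \<otimes> a = y" if "y \<in> P" for y
    proof -
      obtain i j :: nat where "a = x [^] i" "y = x [^] j"
        using a subsetD[OF PA \<open>y \<in> P\<close>] unfolding A_def generate_pow_on_finite_carrier[OF fin x] by blast
      then have "y \<otimes> a = a \<otimes> y" using x by (simp add: nat_pow_mult add.commute)
      moreover have "a \<in> carrier G" "y \<in> carrier G" using a that PA Ac by auto
      ultimately show ?thesis
        by (metis inv_closed l_inv l_one m_assoc)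
    qed
    then show "a \<in> N" using a Ac by (auto simp: N_def)
  qed
  \<comment> \<open>Conjugation preserves the equation that cuts \<open>P\<close> out of
    \<open>A\<close>, so a conjugate of \<open>P\<close> that lies in \<open>A\<close> already lies
    in \<open>P\<close>.\<close>
  have fixed_iff: "(\<forall>y\<in>P. inv g \<otimes> y \<otimes> g \<in> A) \<longleftrightarrow> g \<in> N" if "g \<in> carrier G" for g
    using that PA Ac by (auto simp: N_def P_def A_def conjugate_pow subset_iff)
  \<comment> \<open>An orbit length divides \<open>card P\<close>, a power of \<open>p\<close>, so
    it is 1 or a multiple of \<open>p\<close>.\<close>
  have orbits: "(\<forall>y\<in>P. inv g \<otimes> y \<otimes> g \<in> A) \<or> p dvd card P div card {y \<in> P. inv g \<otimes> y \<otimes> g \<in> A}"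
    if g: "g \<in> carrier G" for g
  proof (rule disjCI)
    let ?S = "{y \<in> P. inv g \<otimes> y \<otimes> g \<in> A}"
    assume "\<not> p dvd card P div card ?S"
    moreover have "card ?S dvd card P"
      using subgroup_conjugate_preimage[OF P A g] P by (intro card_subgroup_dvd_card_subgroup) auto
    then obtain k where k: "card P = card ?S * k" by auto
    moreover have "card P > 0" using cardP e pos by (auto intro: Nat.gr0I)
    ultimately have "\<not> p dvd k" by auto
    moreover have "k dvd p ^ multiplicity p (ord x)" using k cardP e_def by (metis dvd_triv_right)
    then obtain i where i: "k = p ^ i" using p by (auto simp: divides_primepow_nat)
    ultimately have "k = 1" by (cases i) auto
    then have "card ?S = card P" using k by simp
    moreover have "finite P" using finite_subset[OF subset_trans[OF PA Ac] fin] .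
    ultimately have "?S = P" by (intro card_subset_eq) auto
    then show "\<forall>y\<in>P. inv g \<otimes> y \<otimes> g \<in> A" by blast
  qed
  have cosets: "card (lcosets A) = m"
    using l_lagrange[OF fin A] m pos cardA by simp
  \<comment> \<open>\<open>f\<close> is the index of \<open>A\<close> in \<open>N\<close>. By
    \<open>fixed_iff\<close> the fixed cosets are the cosets of \<open>A\<close> inside
    \<open>N\<close>, so there are \<open>f\<close> of them.\<close>
  obtain f where "card N = card A * f"
    using card_subgroup_dvd_card_subgroup[OF A N AN] by (rule dvdE)
  then have f: "card N = f * card A" by simp
  have "{g <# A | g. g \<in> carrier G \<and> (\<forall>y\<in>P. inv g \<otimes> y \<otimes> g \<in> A)} = {g <# A | g. g \<in> N}"
    using fixed_iff subgroup.subset[OF N] by (intro Collect_cong ex_cong1) blast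
  also have "\<dots> = lcosets\<^bsub>G\<lparr>carrier := N\<rparr>\<^esub> A"
    by (auto simp: LCOSETS_def)
  finally have "{g <# A | g. g \<in> carrier G \<and> (\<forall>y\<in>P. inv g \<otimes> y \<otimes> g \<in> A)} =
    lcosets\<^bsub>G\<lparr>carrier := N\<rparr>\<^esub> A" .
  moreover have "card (lcosets\<^bsub>G\<lparr>carrier := N\<rparr>\<^esub> A) = f"
    using group.l_lagrange[OF subgroup_imp_group[OF N] _ subgroup_incl[OF A N AN]] f cardA pos
      finite_subset[OF subgroup.subset[OF N] fin] by (simp add: order_def)
  ultimately have mf: "[m = f] (mod p)"
    using cong_card_fixed_lcosets[OF fin P A orbits] cosets by simp
  have "f * ord x dvd m * ord x"
    using card_subgroup_dvd_card_subgroup[OF N subgroup_self subgroup.subset[OF N]] f m(1) cardA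
    by (simp add: order_def)
  then have "f dvd m" using pos by simp
  have "m > 0" using m(3) by (intro Nat.gr0I) auto
  then have "f \<le> m" "f > 0" using \<open>f dvd m\<close> by (auto intro: dvd_imp_le Nat.gr0I)
  \<comment> \<open>Now \<open>m = f + k * p\<close>, and \<open>m < 2 * p\<close> leaves
    \<open>k = 0\<close>, where \<open>N\<close> is the whole group, or \<open>k = 1\<close>, where
    \<open>N\<close> turns out to be \<open>A\<close>.\<close>
  then have "p dvd m - f" using mf by (simp add: cong_altdef_nat)
  then obtain k where "m - f = p * k" by auto
  then have k: "m = f + k * p" using \<open>f \<le> m\<close> by (metis le_add_diff_inverse mult.commute)
  have "k < 2"
    using k m(2) mult_le_mono1[of 2 k p] by (cases "2 \<le> k") linarith+
  then consider "k = 0" | "k = 1" by linarith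
  then show ?thesis
  proof cases
    case 1
    then have "card N = card (carrier G)" using k f m(1) cardA by (simp add: order_def)
    then have "N = carrier G" using fin subgroup.subset[OF N] by (intro card_subset_eq)
    then show ?thesis by (auto simp: N_def)
  next
    case 2
    \<comment> \<open>\<open>f\<close> divides both \<open>m\<close> and \<open>m - f = p\<close>,
      and \<open>f = p\<close> would make \<open>p\<close> divide \<open>m\<close>.\<close>
    then have "f dvd p" using k \<open>f dvd m\<close> by (metis dvd_add_triv_left_iff dvd_refl dvd_add_right_iff mult_1)
    then have "f = 1" using p m(3) k 2 by (auto simp: prime_nat_iff)
    then have "card A = card N" using f by simp
    then have "A = N"
      using AN finite_subset[OF subgroup.subset[OF N] fin] by (intro card_subset_eq) auto
    then show ?thesis using k 2 \<open>f = 1\<close> by (auto simp: N_def A_def)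
  qed
qed

subsection \<open>Groups with an abelian maximal subgroup\<close>

lemma (in group) conjugate_eq_self_iff:
  assumes "g \<in> carrier G" "x \<in> carrier G"
  shows "inv g \<otimes> x \<otimes> g = x \<longleftrightarrow> x \<otimes> g = g \<otimes> x"
proof -
  have "g \<otimes> (inv g \<otimes> x \<otimes> g) = x \<otimes> g"
    using assms by (simp add: m_assoc[symmetric])
  then show ?thesis
    using assms l_cancel[of g "inv g \<otimes> x \<otimes> g" x] by auto
qed

lemma (in group) subgroup_centralizer:
  assumes "y \<in> carrier G"
  shows "subgroup {c \<in> carrier G. c \<otimes> y = y \<otimes> c} G"
proof
  fix c d assume cd: "c \<in> {c \<in> carrier G. c \<otimes> y = y \<otimes> c}" "d \<in> {c \<in> carrier G. c \<otimes> y = y \<otimes> c}"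
  then have "(c \<otimes> d) \<otimes> y = c \<otimes> (y \<otimes> d)" using assms by (simp add: m_assoc)
  also have "\<dots> = (y \<otimes> c) \<otimes> d" using cd assms by (simp flip: m_assoc)
  finally show "c \<otimes> d \<in> {c \<in> carrier G. c \<otimes> y = y \<otimes> c}"
    using cd assms by (simp add: m_assoc)
next
  fix c assume c: "c \<in> {c \<in> carrier G. c \<otimes> y = y \<otimes> c}"
  then have "inv (inv c) \<otimes> y \<otimes> inv c = y" using assms by (simp add: m_assoc)
  then show "inv c \<in> {c \<in> carrier G. c \<otimes> y = y \<otimes> c}"
    using c assms conjugate_eq_self_iff[of "inv c" y] by simp
qed (use assms in auto)

section \<open>Solvability of abelian groups and of extensions\<close>

lemma (in comm_group) solvable_comm_group: "solvable G"
  using trivial_derived_seq_imp_solvable[OF subgroup_self, of 1] derived_eq_singleton[of "carrier G"]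
  by (simp add: solvable_def)

text \<open>This specializes \<open>solvable_condition\<close>, which concerns a pair of
  homomorphisms, to the inclusion of \<open>H\<close> and the projection onto
  \<open>G Mod H\<close>.\<close>

lemma (in normal) solvable_extension:
  assumes "solvable (G\<lparr>carrier := H\<rparr>)" "solvable (G Mod H)"
  shows "solvable G"
proof -
  have 1: "group_hom (G\<lparr>carrier := H\<rparr>) G id"
    using subgroup_imp_group[OF subgroup_axioms] is_group subset
    by (auto simp: group_hom_def group_hom_axioms_def hom_def)
  have 2: "group_hom G (G Mod H) (\<lambda>a. H #> a)"
    using is_group factorgroup_is_group r_coset_hom_Mod
    by (auto simp: group_hom_def group_hom_axioms_def)
  have 3: "kernel G (G Mod H) (\<lambda>a. H #> a) \<subseteq> id ` carrier (G\<lparr>carrier := H\<rparr>)"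
    using rcos_self[OF _ subgroup_axioms] by (auto simp: kernel_def)
  show ?thesis
    using solvable_condition[OF 1 2 _ 3 assms] by (simp add: carrier_FactGroup)
qed

text \<open>Any element other than the identity generates the group, so it is even cyclic.\<close>

lemma (in group) comm_group_prime_order:
  assumes "prime (order G)"
  shows "comm_group G"
proof -
  have fin: "finite (carrier G)"
    using prime_gt_0_nat[OF assms] order_gt_0_iff_finite by simp
  have "carrier G \<noteq> {\<one>}"
    using assms by (auto simp: order_def)
  moreover have "\<one> \<in> carrier G" by simp
  ultimately obtain x where x: "x \<in> carrier G" "x \<noteq> \<one>" by blast
  have "ord x = order G"
    using assms ord_dvd_group_order[OF x(1)] ord_eq_1[OF x(1)] x(2) by (auto simp: prime_nat_iff)
  then have "generate G {x} = carrier G"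
    using fin x generate_incl[of "{x}"] generate_pow_card[of x]
    by (intro card_subset_eq) (auto simp: order_def)
  then have "cyclic_group G"
    using cyclic_group_generate[OF x(1)] by simp
  then show ?thesis by (rule cyclic_imp_abelian_group)
qed

text \<open>A form of Frobenius' theorem. The identity and the elements lying in no conjugate of \<open>A\<close>
  form a set \<open>K\<close> of \<open>m\<close> elements. If \<open>m = p\<close>, then \<open>K\<close> is a Sylow \<open>p\<close>-subgroup; if \<open>m = p + 1\<close>,
  then \<open>A\<close> has order \<open>p\<close> and permutes \<open>K - {\<one>}\<close> transitively, so that \<open>K\<close> is the
  centralizer of each of its non-trivial elements.\<close>

lemma (in group) solvable_malnormal_abelian:
  assumes fin: "finite (carrier G)" and A: "subgroup A G"
    and comm: "\<And>a b. a \<in> A \<Longrightarrow> b \<in> A \<Longrightarrow> a \<otimes> b = b \<otimes> a"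
    and malnormal: "\<And>g a. g \<in> carrier G \<Longrightarrow> a \<in> A \<Longrightarrow> inv g \<otimes> a \<otimes> g \<in> A \<Longrightarrow> a \<noteq> \<one> \<Longrightarrow> g \<in> A"
    and nontriv: "A \<noteq> {\<one>}"
    and p: "prime p" and m: "order G = m * card A" "m = p \<or> m = p + 1"
  shows "solvable G"
proof -
  interpret A: subgroup A G by fact
  define U where "U = {x \<in> carrier G. x \<noteq> \<one> \<and> (\<exists>g\<in>carrier G. inv g \<otimes> x \<otimes> g \<in> A)}"
  define K where "K = carrier G - U"
  have finA: "finite A" using A.subset fin finite_subset by blast
  have cardA: "card A > 0" using finA A.one_closed card_gt_0_iff by blast
  have conj_one: "inv g \<otimes> x \<otimes> g = \<one> \<longleftrightarrow> x = \<one>" if "g \<in> carrier G" "x \<in> carrier G" for g x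
    using that inj_on_conjugate[OF that(1)] unfolding inj_on_def
    by (metis l_inv one_closed r_one inv_closed)
  have conj_cancel: "inv g \<otimes> (g \<otimes> x \<otimes> inv g) \<otimes> g = x" "g \<otimes> (inv g \<otimes> x \<otimes> g) \<otimes> inv g = x"
    if "g \<in> carrier G" "x \<in> carrier G" for g x
  proof -
    have "inv g \<otimes> (g \<otimes> x \<otimes> inv g) \<otimes> g = (inv g \<otimes> g) \<otimes> x \<otimes> (inv g \<otimes> g)"
      using that by (simp only: m_assoc m_closed inv_closed)
    then show "inv g \<otimes> (g \<otimes> x \<otimes> inv g) \<otimes> g = x" using that by simp
    have "g \<otimes> (inv g \<otimes> x \<otimes> g) \<otimes> inv g = (g \<otimes> inv g) \<otimes> x \<otimes> (g \<otimes> inv g)"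
      using that by (simp only: m_assoc m_closed inv_closed)
    then show "g \<otimes> (inv g \<otimes> x \<otimes> g) \<otimes> inv g = x" using that by simp
  qed
  have conj_one': "g \<otimes> x \<otimes> inv g = \<one> \<longleftrightarrow> x = \<one>" if "g \<in> carrier G" "x \<in> carrier G" for g x
    using that conj_one[of "inv g" x] by simp
  have conj_conj: "inv h \<otimes> (inv g \<otimes> x \<otimes> g) \<otimes> h = inv (g \<otimes> h) \<otimes> x \<otimes> (g \<otimes> h)"
    if "g \<in> carrier G" "h \<in> carrier G" "x \<in> carrier G" for g h x
    using that by (simp add: inv_mult_group m_assoc)
  have conj_A: "inv a \<otimes> b \<otimes> a = b" if "a \<in> A" "b \<in> A" for a b
    using comm[OF that] that by (simp add: conjugate_eq_self_iff)
  \<comment> \<open>Double counting of the pairs \<open>(g, x)\<close> with \<open>x \<in> U\<close>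
    and \<open>inv g \<otimes> x \<otimes> g \<in> A\<close>: each \<open>g\<close> occurs
    \<open>card A - 1\<close> times, each \<open>x\<close> occurs \<open>card A\<close>
    times.\<close>
  have cardU: "card U * card A = order G * (card A - 1)"
  proof -
    have "card {x \<in> U. inv g \<otimes> x \<otimes> g \<in> A} = card A - 1" if g: "g \<in> carrier G" for g
    proof -
      have "bij_betw (\<lambda>x. inv g \<otimes> x \<otimes> g) {x \<in> U. inv g \<otimes> x \<otimes> g \<in> A} (A - {\<one>})"
        using g conj_cancel conj_one[OF g]
        by (intro bij_betwI[where g = "\<lambda>x. g \<otimes> x \<otimes> inv g"])
           (auto simp: U_def conj_one' intro!: bexI[of _ g])
      then show ?thesis using bij_betw_same_card A.one_closed finA by fastforce
    qed
    moreover have "card {g \<in> carrier G. inv g \<otimes> x \<otimes> g \<in> A} = card A" if x: "x \<in> U" for x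
    proof -
      obtain g where g: "g \<in> carrier G" "inv g \<otimes> x \<otimes> g \<in> A" and x': "x \<in> carrier G" "x \<noteq> \<one>"
        using x by (auto simp: U_def)
      \<comment> \<open>If \<open>g\<close> and \<open>h\<close> both conjugate \<open>x\<close>
        into \<open>A\<close>, then \<open>inv g \<otimes> h\<close> conjugates a non-identity
        element of \<open>A\<close> into \<open>A\<close>, so malnormality puts it in
        \<open>A\<close>.\<close>
      have "{h \<in> carrier G. inv h \<otimes> x \<otimes> h \<in> A} = (\<lambda>a. g \<otimes> a) ` A"
      proof (intro equalityI subsetI)
        fix h assume h: "h \<in> {h \<in> carrier G. inv h \<otimes> x \<otimes> h \<in> A}"
        have "inv g \<otimes> h \<in> A"
        proof (rule malnormal[OF _ g(2)])
          have "g \<otimes> (inv g \<otimes> h) = h" using g h by (simp add: m_assoc[symmetric])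
          then show "inv (inv g \<otimes> h) \<otimes> (inv g \<otimes> x \<otimes> g) \<otimes> (inv g \<otimes> h) \<in> A"
            using g h x' by (simp add: conj_conj del: inv_mult_group)
        qed (use g h x' conj_one in auto)
        moreover have "h = g \<otimes> (inv g \<otimes> h)" using g h by (simp add: m_assoc[symmetric])
        ultimately show "h \<in> (\<lambda>a. g \<otimes> a) ` A" by blast
      next
        fix h assume "h \<in> (\<lambda>a. g \<otimes> a) ` A"
        then obtain a where a: "a \<in> A" "h = g \<otimes> a" by blast
        have "inv a \<otimes> (inv g \<otimes> x \<otimes> g) \<otimes> a \<in> A" using a g by simp
        then show "h \<in> {h \<in> carrier G. inv h \<otimes> x \<otimes> h \<in> A}"
          using a g x' by (simp add: conj_conj del: inv_mult_group)
      qed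
      then show ?thesis using inj_on_g'[OF A.subset g(1)] card_image by metis
    qed
    moreover have "finite U" using fin by (simp add: U_def)
    ultimately show ?thesis
      using sum_multicount[of "carrier G" U "\<lambda>g x. inv g \<otimes> x \<otimes> g \<in> A" "card A"] fin
      by (simp add: order_def mult.commute)
  qed
  have cardK: "card K = m"
  proof -
    have "card U * card A = (m * (card A - 1)) * card A"
      using cardU m(1) by (simp add: algebra_simps)
    then have "card U = m * (card A - 1)" using cardA by simp
    moreover have "card K = order G - card U"
      unfolding K_def order_def using fin by (intro card_Diff_subset) (auto simp: U_def)
    moreover have "card A = Suc (card A - 1)" using cardA by simp
    ultimately show ?thesis using m(1) by (metis add_diff_cancel_right' mult_Suc_right)
  qed
  have K_iff: "x \<in> K \<longleftrightarrow> x \<in> carrier G \<and> (x = \<one> \<or> (\<forall>g\<in>carrier G. inv g \<otimes> x \<otimes> g \<notin> A))" for x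
    by (auto simp: K_def U_def)
  have KA: "x = \<one>" if "x \<in> K" "x \<in> A" for x
    using that by (auto simp: K_iff dest: bspec[of _ _ \<one>])
  have K_conj: "inv g \<otimes> x \<otimes> g \<in> K" if "g \<in> carrier G" "x \<in> K" for g x
    using that conj_one[of g x] by (auto simp: K_iff conj_conj)
  have finK: "finite K" using fin by (simp add: K_def)
  have m0: "m > 0" using m(2) prime_gt_0_nat[OF p] by auto
  \<comment> \<open>Let \<open>A\<close> act on its own \<open>m\<close> cosets. Malnormality makes
    \<open>A\<close> the only fixed coset and all other stabilizers trivial, so the remaining orbits
    have length \<open>card A\<close>.\<close>
  have dvd: "card A dvd m - 1"
  proof -
    have 1: "(\<forall>h\<in>A. inv g \<otimes> h \<otimes> g \<in> A) \<longleftrightarrow> g \<in> A" if "g \<in> carrier G" for g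
      using nontriv malnormal[OF that] A.one_closed by auto
    have "[card (lcosets A) =
        card {g <# A | g. g \<in> carrier G \<and> (\<forall>h\<in>A. inv g \<otimes> h \<otimes> g \<in> A)}] (mod (card A))"
    proof (rule cong_card_fixed_lcosets[OF fin A A])
      fix g assume g: "g \<in> carrier G"
      show "(\<forall>h\<in>A. inv g \<otimes> h \<otimes> g \<in> A) \<or> card A dvd card A div card {h \<in> A. inv g \<otimes> h \<otimes> g \<in> A}"
      proof (cases "g \<in> A")
        case False
        then have "{h \<in> A. inv g \<otimes> h \<otimes> g \<in> A} = {\<one>}"
          using malnormal[OF g] g by auto
        then show ?thesis by simp
      qed (use 1[OF g] in simp)
    qed
    moreover have "{g <# A | g. g \<in> carrier G \<and> (\<forall>h\<in>A. inv g \<otimes> h \<otimes> g \<in> A)} = {A}"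
    proof -
      have "g <# A = A" if "g \<in> A" for g
        using coset_join3[OF A.mem_carrier[OF that] A that] .
      moreover from this[OF A.one_closed] have "A = \<one> <# A" by simp
      ultimately show ?thesis using 1 A.one_closed A.mem_carrier by blast
    qed
    moreover have "card (lcosets A) = m"
      using l_lagrange[OF fin A] m(1) cardA by simp
    ultimately show ?thesis
      using m0 cong_altdef_nat[of 1 m "card A"] by simp
  qed
  have "subgroup K G \<and> (\<forall>x\<in>K. \<forall>y\<in>K. x \<otimes> y = y \<otimes> x)"
    using m(2)
  proof
    assume mp: "m = p"
    obtain H where H: "subgroup H G" "card H = p"
      using sylow_thm[OF p is_group _ fin, of 1 "card A"] m(1) mp by auto
    have "coprime (card A) p"
    proof (rule ccontr)
      assume "\<not> coprime (card A) p"
      then have "p dvd card A"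
        using p by (metis coprime_commute prime_imp_coprime)
      then have "p dvd p - 1" using dvd mp dvd_trans by blast
      then show False using prime_ge_2_nat[OF p] by (auto dest: dvd_imp_le)
    qed
    \<comment> \<open>An element of \<open>H\<close> that is conjugate into \<open>A\<close> has
      order dividing both \<open>p\<close> and \<open>card A\<close>, which are coprime, so it is
      the identity. Comparing cardinalities then gives \<open>H = K\<close>.\<close>
    have "H \<subseteq> K"
    proof
      fix x assume x: "x \<in> H"
      then have xc: "x \<in> carrier G" using H(1) subgroup.subset by blast
      have "x = \<one>" if g: "g \<in> carrier G" "inv g \<otimes> x \<otimes> g \<in> A" for g
      proof -
        let ?y = "inv g \<otimes> x \<otimes> g"
        have "x [^] p = \<one>"
          using group.pow_order_eq_1[OF subgroup_imp_group[OF H(1)], of x] x H(2)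
          by (simp add: order_def flip: nat_pow_consistent)
        then have "?y [^] p = \<one>" using g xc by (simp add: conjugate_pow)
        moreover have "?y [^] card A = \<one>"
          using group.pow_order_eq_1[OF subgroup_imp_group[OF A], of ?y] g
          by (simp add: order_def flip: nat_pow_consistent)
        ultimately have "ord ?y dvd p" "ord ?y dvd card A" using g xc by (simp_all add: pow_eq_id)
        then have "ord ?y = 1" using \<open>coprime (card A) p\<close> by (metis coprime_common_divisor_nat)
        then show ?thesis using ord_eq_1[of ?y] conj_one g xc by simp
      qed
      then show "x \<in> K" using xc by (auto simp: K_iff)
    qed
    then have "H = K" using finK H(2) cardK mp by (intro card_subset_eq) auto
    moreover have "comm_group (G\<lparr>carrier := H\<rparr>)"
      using H p by (intro group.comm_group_prime_order subgroup_imp_group) (simp_all add: order_def)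
    then have "x \<otimes> y = y \<otimes> x" if "x \<in> H" "y \<in> H" for x y
      using comm_monoid.m_comm[OF comm_group.axioms(1), of "G\<lparr>carrier := H\<rparr>" x y] that by simp
    ultimately show ?thesis using H by blast
  next
    assume mp: "m = p + 1"
    have "card A \<noteq> 1"
      using nontriv A.one_closed by (metis card_1_singletonE singletonD)
    \<comment> \<open>Here \<open>m - 1 = p\<close>, so \<open>A\<close> has as many elements as
      \<open>K - {\<one>}\<close>.\<close>
    then have Ap: "card A = p" using dvd mp p by (auto simp: prime_nat_iff)
    have cent: "K = {c \<in> carrier G. c \<otimes> y = y \<otimes> c}" if y: "y \<in> K" "y \<noteq> \<one>" for y
    proof -
      let ?C = "{c \<in> carrier G. c \<otimes> y = y \<otimes> c}"
      have yc: "y \<in> carrier G" using y by (simp add: K_iff)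
      have not_A: "inv g \<otimes> y \<otimes> g \<notin> A" if "g \<in> carrier G" for g
        using y that by (auto simp: K_iff)
      \<comment> \<open>If some \<open>c \<noteq> \<one>\<close> commuting with \<open>y\<close>
        were conjugate into \<open>A\<close> by \<open>g\<close>, then the conjugate
        \<open>?z\<close> of \<open>y\<close> would centralize a non-identity element of
        \<open>A\<close> and so lie in \<open>A\<close>, against \<open>y \<in> K\<close>.\<close>
      have CK: "?C \<subseteq> K"
      proof
        fix c assume c: "c \<in> ?C"
        have "c = \<one>" if g: "g \<in> carrier G" "inv g \<otimes> c \<otimes> g \<in> A" for g
        proof (rule ccontr)
          assume "c \<noteq> \<one>"
          let ?z = "inv g \<otimes> y \<otimes> g"
          have "inv (g \<otimes> ?z) \<otimes> c \<otimes> (g \<otimes> ?z) = inv g \<otimes> c \<otimes> g"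
          proof -
            have "g \<otimes> ?z = y \<otimes> g" using g yc by (simp add: m_assoc[symmetric])
            moreover have "inv y \<otimes> c \<otimes> y = c"
              using c yc by (simp add: conjugate_eq_self_iff)
            then have "inv g \<otimes> (inv y \<otimes> c \<otimes> y) \<otimes> g = inv g \<otimes> c \<otimes> g" by simp
            ultimately show ?thesis using g yc c by (simp add: conj_conj del: inv_mult_group)
          qed
          then have "inv ?z \<otimes> (inv g \<otimes> c \<otimes> g) \<otimes> ?z \<in> A"
            using g yc c by (simp add: conj_conj del: inv_mult_group)
          then have "?z \<in> A"
            using malnormal[of ?z "inv g \<otimes> c \<otimes> g"] g yc c conj_one[of g c] \<open>c \<noteq> \<one>\<close> by simp
          then show False using not_A g by blast
        qed
        then show "c \<in> K" using c by (auto simp: K_iff)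
      qed
      \<comment> \<open>The action of \<open>A\<close> is free, since
        \<open>a \<otimes> inv b\<close> centralizing \<open>y\<close> lies in both \<open>K\<close>
        and \<open>A\<close>. Equal cardinalities then give transitivity.\<close>
      have orbit: "(\<lambda>a. inv a \<otimes> y \<otimes> a) ` A = K - {\<one>}"
      proof (rule card_subset_eq)
        show "(\<lambda>a. inv a \<otimes> y \<otimes> a) ` A \<subseteq> K - {\<one>}"
          using K_conj[OF _ y(1)] conj_one[OF _ yc] y(2) by auto
        have "inj_on (\<lambda>a. inv a \<otimes> y \<otimes> a) A"
        proof (rule inj_onI)
          fix a b assume ab: "a \<in> A" "b \<in> A" "inv a \<otimes> y \<otimes> a = inv b \<otimes> y \<otimes> b"
          have ab': "a \<in> carrier G" "b \<in> carrier G" using ab by auto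
          let ?c = "a \<otimes> inv b"
          have "inv ?c \<otimes> y \<otimes> ?c = y"
          proof -
            have "inv ?c \<otimes> y \<otimes> ?c = inv (inv b) \<otimes> (inv a \<otimes> y \<otimes> a) \<otimes> inv b"
              using ab' yc conj_conj[of a "inv b" y] by simp
            also have "\<dots> = b \<otimes> (inv b \<otimes> y \<otimes> b) \<otimes> inv b" using ab ab' by simp
            also have "\<dots> = y" using conj_cancel(2)[OF ab'(2) yc] .
            finally show ?thesis .
          qed
          then have "?c \<otimes> y = y \<otimes> ?c"
            using ab' yc conjugate_eq_self_iff[of ?c y] by simp
          then have "?c \<in> K" using CK ab' by auto
          then have "?c = \<one>" using KA ab by simp
          then show "a = b" using ab' inv_equality[of a "inv b"] by simp
        qed
        then show "card ((\<lambda>a. inv a \<otimes> y \<otimes> a) ` A) = card (K - {\<one>})"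
          using card_image[of _ A] Ap cardK mp finK by (simp add: K_iff)
      qed (use finK in simp)
      \<comment> \<open>Frattini argument: every conjugate of \<open>y\<close> is a conjugate by
        some element of \<open>A\<close>, so each \<open>g\<close> is a product of an element of
        \<open>?C\<close> and one of \<open>A\<close>. Hence \<open>?C\<close> has at least
        \<open>m\<close> elements, as many as \<open>K\<close>.\<close>
      have "carrier G \<subseteq> (\<lambda>(c, a). c \<otimes> a) ` (?C \<times> A)"
      proof
        fix g assume g: "g \<in> carrier G"
        then have "inv g \<otimes> y \<otimes> g \<in> (\<lambda>a. inv a \<otimes> y \<otimes> a) ` A"
          unfolding orbit using K_conj[OF g y(1)] conj_one[OF g yc] y(2) by simp
        then obtain a where a: "a \<in> A" "inv g \<otimes> y \<otimes> g = inv a \<otimes> y \<otimes> a" by blast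
        have ac: "a \<in> carrier G" using a by simp
        let ?c = "g \<otimes> inv a"
        have "inv ?c \<otimes> y \<otimes> ?c = inv (inv a) \<otimes> (inv g \<otimes> y \<otimes> g) \<otimes> inv a"
          using g ac yc conj_conj[of g "inv a" y] by simp
        also have "\<dots> = y" using a ac yc conj_cancel by simp
        finally have "?c \<otimes> y = y \<otimes> ?c"
          using g ac yc conjugate_eq_self_iff[of ?c y] by simp
        moreover have "g = ?c \<otimes> a" using g ac by (simp add: m_assoc)
        ultimately show "g \<in> (\<lambda>(c, a). c \<otimes> a) ` (?C \<times> A)" using g ac a by force
      qed
      then have "card (carrier G) \<le> card (?C \<times> A)"
        using fin finA by (intro surj_card_le) auto
      then have "m \<le> card ?C" using m(1) cardA by (simp add: card_cartesian_product order_def)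
      then show "K = ?C" using CK finK cardK card_seteq by metis
    qed
    have "K \<noteq> {\<one>}" using cardK mp prime_gt_0_nat[OF p] by auto
    moreover have "\<one> \<in> K" by (simp add: K_iff)
    ultimately obtain y where y: "y \<in> K" "y \<noteq> \<one>" by blast
    have yc: "y \<in> carrier G" using y by (simp add: K_iff)
    have "subgroup K G"
      unfolding cent[OF y] using yc by (rule subgroup_centralizer)
    moreover have "x \<otimes> z = z \<otimes> x" if "x \<in> K" "z \<in> K" for x z
      using cent[of z] that by (cases "z = \<one>") (auto simp: K_iff)
    ultimately show ?thesis by blast
  qed
  then have K: "subgroup K G" and Kcomm: "\<And>x y. x \<in> K \<Longrightarrow> y \<in> K \<Longrightarrow> x \<otimes> y = y \<otimes> x" by auto
  have "x \<otimes> h \<otimes> inv x \<in> K" if "x \<in> carrier G" "h \<in> K" for x h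
    using K_conj[of "inv x" h] that by simp
  then have normal: "K \<lhd> G" using K normal_inv_iff by blast
  have "comm_group (G\<lparr>carrier := K\<rparr>)"
    using Kcomm by (intro group.group_comm_groupI subgroup_imp_group[OF K]) auto
  then have "solvable (G\<lparr>carrier := K\<rparr>)" by (rule comm_group.solvable_comm_group)
  \<comment> \<open>\<open>K\<close> and \<open>A\<close> meet trivially and the product of their
    orders is the group order, so every coset of \<open>K\<close> has a representative in the
    abelian group \<open>A\<close>.\<close>
  moreover have "comm_group (G Mod K)"
  proof (rule group.group_comm_groupI[OF normal.factorgroup_is_group[OF normal]])
    have inj: "inj_on (\<lambda>(k, a). k \<otimes> a) (K \<times> A)"
    proof (rule inj_onI, clarify)
      fix k a l b assume *: "k \<in> K" "a \<in> A" "l \<in> K" "b \<in> A" "k \<otimes> a = l \<otimes> b"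
      then have c: "k \<in> carrier G" "a \<in> carrier G" "l \<in> carrier G" "b \<in> carrier G"
        by (auto simp: K_iff)
      have "inv l \<otimes> k = inv l \<otimes> (k \<otimes> a) \<otimes> inv a" using c by (simp add: m_assoc)
      also have "\<dots> = (inv l \<otimes> l) \<otimes> b \<otimes> inv a" using c *(5) by (simp only: m_assoc m_closed inv_closed)
      also have "\<dots> = b \<otimes> inv a" using c by simp
      finally have "inv l \<otimes> k = b \<otimes> inv a" .
      moreover have "inv l \<otimes> k \<in> K" "b \<otimes> inv a \<in> A"
        using * K by (auto simp: subgroup.m_closed subgroup.m_inv_closed)
      ultimately have "inv l \<otimes> k = \<one>" "b \<otimes> inv a = \<one>" using KA by auto
      then show "k = l \<and> a = b"
        using c inv_equality[of "inv l" k] inv_equality[of b "inv a"] by (auto simp: inv_eq_1_iff)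
    qed
    have surj: "(\<lambda>(k, a). k \<otimes> a) ` (K \<times> A) = carrier G"
    proof (rule card_subset_eq[OF fin])
      show "card ((\<lambda>(k, a). k \<otimes> a) ` (K \<times> A)) = card (carrier G)"
        using card_image[OF inj] cardK m(1) by (simp add: card_cartesian_product order_def)
    qed (auto simp: K_iff)
    have rep: "\<exists>a\<in>A. C = K #> a" if "C \<in> carrier (G Mod K)" for C
    proof -
      obtain g where g: "g \<in> carrier G" "C = K #> g"
        using \<open>C \<in> carrier (G Mod K)\<close> by (auto simp: carrier_FactGroup)
      then have "g \<in> (\<lambda>(k, a). k \<otimes> a) ` (K \<times> A)" using surj by simp
      then obtain k a where ka: "k \<in> K" "a \<in> A" "g = k \<otimes> a" by auto
      have "K #> g = K #> a"
        using ka subgroup.subset[OF K] K coset_mult_assoc[of K k a] coset_join2[of k K]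
        by (auto simp: subsetD)
      then show ?thesis using g ka by blast
    qed
    fix C D assume "C \<in> carrier (G Mod K)" "D \<in> carrier (G Mod K)"
    then obtain a b where ab: "a \<in> A" "b \<in> A" "C = K #> a" "D = K #> b" using rep by blast
    then show "C \<otimes>\<^bsub>G Mod K\<^esub> D = D \<otimes>\<^bsub>G Mod K\<^esub> C"
      using normal.rcos_sum[OF normal, of a b] normal.rcos_sum[OF normal, of b a] comm[of a b] by simp
  qed
  then have "solvable (G Mod K)" by (rule comm_group.solvable_comm_group)
  ultimately show ?thesis by (rule normal.solvable_extension[OF normal])
qed

section \<open>The center and the quotient by it\<close>

lemma (in group) subgroup_center:
  "subgroup {z \<in> carrier G. \<forall>g\<in>carrier G. g \<otimes> z = z \<otimes> g} G"
proof -
  have "subgroup (\<Inter>g\<in>carrier G. {z \<in> carrier G. z \<otimes> g = g \<otimes> z}) G"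
    using subgroup_centralizer by (intro subgroups_Inter) auto
  also have "(\<Inter>g\<in>carrier G. {z \<in> carrier G. z \<otimes> g = g \<otimes> z}) =
      {z \<in> carrier G. \<forall>g\<in>carrier G. g \<otimes> z = z \<otimes> g}"
    using one_closed by (auto simp del: one_closed)
  finally show ?thesis .
qed

text \<open>If \<open>A\<close> is not normal, it is its own normalizer, so an element of \<open>A\<close> with a conjugate in \<open>A\<close> by
  an element outside \<open>A\<close> is centralized by two different conjugates of \<open>A\<close>, hence by \<open>G\<close>. Thus the
  image of \<open>A\<close> modulo the center is malnormal.\<close>

lemma (in group) solvable_maximal_abelian:
  assumes fin: "finite (carrier G)" and max: "maximal_subgroup G A"
    and comm: "\<And>a b. a \<in> A \<Longrightarrow> b \<in> A \<Longrightarrow> a \<otimes> b = b \<otimes> a"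
    and not_normal: "\<not> A \<lhd> G"
    and p: "prime p" and m: "order G = m * card A" "m = p \<or> m = p + 1"
  shows "solvable G"
proof -
  define Z where "Z = {z \<in> carrier G. \<forall>g\<in>carrier G. g \<otimes> z = z \<otimes> g}"
  have A: "subgroup A G" using max by (simp add: maximal_subgroup_def)
  interpret A: subgroup A G by (rule A)
  have maxD: "H = A \<or> H = carrier G" if "subgroup H G" "A \<subseteq> H" for H
    using max that by (auto simp: maximal_subgroup_def)
  have finA: "finite A" using A.subset fin finite_subset by blast
  have Z: "subgroup Z G" unfolding Z_def by (rule subgroup_center)
  have ZD: "z \<in> carrier G" "g \<otimes> z = z \<otimes> g" if "z \<in> Z" "g \<in> carrier G" for z g
    using that by (auto simp: Z_def)
  have "x \<otimes> z \<otimes> inv x \<in> Z" if "x \<in> carrier G" "z \<in> Z" for x z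
    using that ZD[OF that(2,1)] by (simp add: m_assoc)
  then have Zn: "Z \<lhd> G" using Z normal_inv_iff by blast
  interpret Z: normal Z G by (rule Zn)
  \<comment> \<open>By maximality the normalizer of \<open>A\<close> is \<open>A\<close> or the
    whole group, and the latter would make \<open>A\<close> normal.\<close>
  have normalizer: "g \<in> A" if g: "g \<in> carrier G" "\<And>y. y \<in> A \<Longrightarrow> inv g \<otimes> y \<otimes> g \<in> A" for g
  proof -
    let ?N = "{g \<in> carrier G. \<forall>y\<in>A. inv g \<otimes> y \<otimes> g \<in> A}"
    have "subgroup ?N G" using finA A.subset by (rule finite_subgroup_normalizer)
    moreover have "A \<subseteq> ?N" by auto
    moreover have "?N \<noteq> carrier G"
    proof
      assume *: "?N = carrier G"
      have "x \<otimes> h \<otimes> inv x \<in> A" if "x \<in> carrier G" "h \<in> A" for x h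
      proof -
        have "inv x \<in> ?N" using * that by simp
        then show ?thesis using that by simp
      qed
      then show False using not_normal A normal_inv_iff by blast
    qed
    ultimately have "?N = A" using maxD by blast
    then show ?thesis using g by blast
  qed
  have ZA: "Z \<subseteq> A"
  proof
    fix z assume z: "z \<in> Z"
    have "inv z \<otimes> y \<otimes> z = y" if "y \<in> A" for y
      using that z ZD[OF z, of y] by (simp add: conjugate_eq_self_iff)
    then show "z \<in> A" using normalizer[of z] z by simp
  qed
  have TI: "a \<in> Z" if g: "g \<in> carrier G" "g \<notin> A" and a: "a \<in> A" "inv g \<otimes> a \<otimes> g \<in> A" for g a
  proof -
    let ?C = "{c \<in> carrier G. c \<otimes> a = a \<otimes> c}"
    have ac: "a \<in> carrier G" using a by simp
    have C: "subgroup ?C G" using ac by (rule subgroup_centralizer)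
    have "\<not> ?C = A"
    proof
      assume CA: "?C = A"
      \<comment> \<open>The conjugate of \<open>A\<close> by \<open>inv g\<close> is abelian and
        contains \<open>a\<close>, so it lies in \<open>?C = A\<close>; then \<open>inv g\<close>
        normalizes \<open>A\<close>, which contradicts \<open>g \<notin> A\<close>.\<close>
      have "inv (inv g) \<otimes> y \<otimes> inv g \<in> A" if y: "y \<in> A" for y
      proof -
        have yc: "y \<in> carrier G" using y by simp
        have "(g \<otimes> y \<otimes> inv g) \<otimes> a = g \<otimes> (y \<otimes> (inv g \<otimes> a \<otimes> g)) \<otimes> inv g"
          using g ac yc by (simp add: m_assoc)
        also have "\<dots> = g \<otimes> ((inv g \<otimes> a \<otimes> g) \<otimes> y) \<otimes> inv g"
          using comm[OF y a(2)] by simp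
        also have "\<dots> = (g \<otimes> inv g) \<otimes> a \<otimes> (g \<otimes> y \<otimes> inv g)"
          using g ac yc by (simp only: m_assoc m_closed inv_closed)
        also have "\<dots> = a \<otimes> (g \<otimes> y \<otimes> inv g)" using g ac yc by simp
        finally have "g \<otimes> y \<otimes> inv g \<in> ?C" using g yc by simp
        then show ?thesis using CA g by simp
      qed
      then have "inv g \<in> A" using normalizer[of "inv g"] g by simp
      then show False using g A.m_inv_closed[of "inv g"] by simp
    qed
    moreover have "A \<subseteq> ?C" using comm[OF _ a(1)] A.mem_carrier by blast
    ultimately have "?C = carrier G" using maxD[OF C] by simp
    then have "\<forall>g\<in>carrier G. g \<otimes> a = a \<otimes> g" by blast
    then show ?thesis unfolding Z_def using ac by blast
  qed
  define h where "h = (\<lambda>a. Z #> a)"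
  interpret Q: group "G Mod Z" by (rule Z.factorgroup_is_group)
  interpret h: group_hom G "G Mod Z" h
    using Z.r_coset_hom_Mod by unfold_locales (simp add: h_def)
  \<comment> \<open>Since \<open>Z\<close> lies in \<open>A\<close>, membership in the image of
    \<open>A\<close> lifts back to \<open>A\<close>.\<close>
  have hA: "u \<in> A" if u: "u \<in> carrier G" "h u \<in> h ` A" for u
  proof -
    obtain b where b: "b \<in> A" "Z #> u = Z #> b" using u by (auto simp: h_def)
    then have "u \<in> Z #> b" using rcos_self[OF u(1) Z] by simp
    then obtain z where "z \<in> Z" "u = z \<otimes> b" by (auto simp: r_coset_def)
    then show ?thesis using b ZA by auto
  qed
  have hZ: "h z = \<one>\<^bsub>G Mod Z\<^esub>" if "z \<in> Z" for z
    using that Z coset_join2[of z Z] by (simp add: h_def)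
  have hAs: "subgroup (h ` A) (G Mod Z)" by (rule h.subgroup_img_is_subgroup[OF A])
  have "solvable (G Mod Z)"
  proof (rule Q.solvable_malnormal_abelian[OF _ hAs _ _ _ p _ m(2)])
    show "finite (carrier (G Mod Z))" using fin by (simp add: carrier_FactGroup)
    show "x \<otimes>\<^bsub>G Mod Z\<^esub> y = y \<otimes>\<^bsub>G Mod Z\<^esub> x" if xy: "x \<in> h ` A" "y \<in> h ` A" for x y
    proof -
      obtain a b where "a \<in> A" "b \<in> A" "x = h a" "y = h b" using xy by blast
      then show ?thesis
        using comm[of a b] h.hom_mult[of a b] h.hom_mult[of b a] by simp
    qed
    show "C \<in> h ` A"
      if C: "C \<in> carrier (G Mod Z)" and D: "D \<in> h ` A"
        and conj: "inv\<^bsub>G Mod Z\<^esub> C \<otimes>\<^bsub>G Mod Z\<^esub> D \<otimes>\<^bsub>G Mod Z\<^esub> C \<in> h ` A" and D1: "D \<noteq> \<one>\<^bsub>G Mod Z\<^esub>" for C D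
    proof -
      obtain g where g: "g \<in> carrier G" "C = h g" using C by (auto simp: carrier_FactGroup h_def)
      obtain a where a: "a \<in> A" "D = h a" using D by blast
      have "h (inv g \<otimes> a \<otimes> g) \<in> h ` A" using conj g a by simp
      then have conjA: "inv g \<otimes> a \<otimes> g \<in> A" by (rule hA[rotated]) (use g a in simp)
      have "a \<notin> Z" using hZ[of a] D1 a(2) by blast
      then have "g \<in> A" using TI[OF g(1) _ a(1) conjA] by (rule contrapos_np)
      then show ?thesis using g by simp
    qed
    \<comment> \<open>Otherwise \<open>A\<close> would be the center, hence normal.\<close>
    show "h ` A \<noteq> {\<one>\<^bsub>G Mod Z\<^esub>}"
    proof
      assume *: "h ` A = {\<one>\<^bsub>G Mod Z\<^esub>}"
      have "A \<subseteq> Z"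
      proof
        fix a assume a: "a \<in> A"
        then have "Z #> a = Z" using * by (auto simp: h_def)
        then show "a \<in> Z" using rcos_self[OF _ Z, of a] a by simp
      qed
      then show False using ZA not_normal Zn by (metis subset_antisym)
    qed
    \<comment> \<open>The orders of the group and of \<open>A\<close> are both divided by
      \<open>card Z\<close>, so the index stays \<open>m\<close>.\<close>
    have "card Z > 0" using Z.one_closed fin Z.subset finite_subset card_gt_0_iff by blast
    moreover have "order (G Mod Z) * card Z = order G"
      using lagrange[OF Z] by (simp add: order_def FactGroup_def)
    moreover have "card (h ` A) * card Z = card A"
    proof -
      have "rcosets\<^bsub>G\<lparr>carrier := A\<rparr>\<^esub> Z = h ` A" by (auto simp: RCOSETS_def h_def)
      then show ?thesis
        using group.lagrange[OF subgroup_imp_group[OF A] subgroup_incl[OF Z A ZA]] by (simp add: order_def)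
    qed
    ultimately show "order (G Mod Z) = m * card (h ` A)"
      using m(1) by (metis mult.assoc mult_right_cancel not_gr0)
  qed
  moreover have "comm_group (G\<lparr>carrier := Z\<rparr>)"
    using ZD by (intro group.group_comm_groupI subgroup_imp_group[OF Z]) auto
  then have "solvable (G\<lparr>carrier := Z\<rparr>)" by (rule comm_group.solvable_comm_group)
  ultimately show ?thesis using Z.solvable_extension by blast
qed

subsection \<open>The theorem\<close>

lemma (in group) card_rcosets_eq:
  assumes "finite (carrier G)" "subgroup A G" "order G = m * card A"
  shows "card (rcosets A) = m"
proof -
  have "card A > 0"
    using assms finite_subset[OF subgroup.subset] subgroup.one_closed card_gt_0_iff by blast
  then show ?thesis using lagrange[OF assms(2)] assms(3) by simp
qed

lemma (in group) comm_generate_singleton: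
  assumes "x \<in> carrier G" "a \<in> generate G {x}" "b \<in> generate G {x}"
  shows "a \<otimes> b = b \<otimes> a"
proof -
  obtain i j :: int where "a = x [^] i" "b = x [^] j"
    using assms(2,3) unfolding generate_pow[OF assms(1)] by auto
  then show ?thesis using assms(1) by (simp add: add.commute flip: int_pow_mult)
qed

text \<open>The index of \<open>A\<close> in an intermediate subgroup divides \<open>p\<close>, so
  it is 1 or \<open>p\<close>.\<close>

lemma (in group) maximal_subgroup_prime_index:
  assumes "finite (carrier G)" "subgroup A G" "prime p" "order G = p * card A"
  shows "maximal_subgroup G A"
  unfolding maximal_subgroup_def
proof (intro conjI allI impI)
  have cardA: "card A > 0"
    using assms finite_subset[OF subgroup.subset] subgroup.one_closed card_gt_0_iff by blast
  show "A \<noteq> carrier G"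
    using assms(3,4) cardA by (auto simp: order_def)
  fix H assume "subgroup H G \<and> A \<subseteq> H"
  then have H: "subgroup H G" and AH: "A \<subseteq> H" by auto
  have fin: "finite H" using assms(1) subgroup.subset[OF H] finite_subset by blast
  obtain k where k: "card H = card A * k"
    using card_subgroup_dvd_card_subgroup[OF assms(2) H AH] by (rule dvdE)
  have "card H dvd order G"
    using card_subgroup_dvd_card_subgroup[OF H subgroup_self subgroup.subset[OF H]] by (simp add: order_def)
  then have "k dvd p" using k assms(4) cardA by (simp add: mult.commute)
  then have "k = 1 \<or> k = p" using assms(3) by (auto simp: prime_nat_iff)
  then show "H = A \<or> H = carrier G"
  proof
    assume "k = 1"
    then show ?thesis using k AH card_subset_eq[OF fin AH] by simp
  next
    assume "k = p"
    then show ?thesis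
      using k assms(4) card_subset_eq[OF assms(1) subgroup.subset[OF H]] by (simp add: order_def mult.commute)
  qed
qed (use assms in auto)

text \<open>This is the theorem with the bound on \<open>psi\<close> replaced by the element of
  large order that it provides. The cases are whether \<open>p\<close> divides the index
  \<open>m\<close> of the cyclic subgroup, and if not, whether \<open>P\<close> is normal.\<close>

lemma (in group) cyclic_subgroup_index_less_twice_prime:
  assumes fin: "finite (carrier G)" and p: "prime p" and x: "x \<in> carrier G"
    and less: "order G < 2 * p * ord x"
  shows "(\<exists>P. sylow_subgroup G p P \<and> P \<lhd> G \<and> cyclic_group (G\<lparr>carrier := P\<rparr>))
         \<or> (solvable G \<and> (\<exists>M. maximal_subgroup G M \<and> cyclic_group (G\<lparr>carrier := M\<rparr>)
                \<and> (card (rcosets M) = p \<or> card (rcosets M) = p + 1)))"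
proof -
  define A where "A = generate G {x}"
  have A: "subgroup A G" unfolding A_def using x by (intro generate_is_subgroup) auto
  have cardA: "card A = ord x" unfolding A_def using x generate_pow_card by simp
  have pos: "ord x > 0" using ord_ge_1[OF fin x] by simp
  have comm: "a \<otimes> b = b \<otimes> a" if "a \<in> A" "b \<in> A" for a b
    using comm_generate_singleton[OF x] that by (simp add: A_def)
  have cycA: "cyclic_group (G\<lparr>carrier := A\<rparr>)"
    unfolding A_def by (rule cyclic_group_generate[OF x])
  obtain m where "order G = ord x * m" using ord_dvd_group_order[OF x] by (rule dvdE)
  then have m: "order G = m * ord x" by simp
  then have mA: "order G = m * card A" using cardA by simp
  have m2: "m < 2 * p" using less m pos by simp
  have "m > 0" using m fin order_gt_0_iff_finite by (intro Nat.gr0I) auto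
  show ?thesis
  proof (cases "p dvd m")
    case True
    then obtain k where k: "m = p * k" by (rule dvdE)
    then have "k = 1" using m2 \<open>m > 0\<close> prime_gt_0_nat[OF p] by (cases k; cases "k - 1") auto
    then have mp: "m = p" using k by simp
    have max: "maximal_subgroup G A"
      using maximal_subgroup_prime_index[OF fin A p] mA mp by simp
    have "solvable G"
    proof (cases "A \<lhd> G")
      case True
      have "comm_group (G\<lparr>carrier := A\<rparr>)"
        by (rule group.cyclic_imp_abelian_group[OF subgroup_imp_group[OF A] cycA])
      then have "solvable (G\<lparr>carrier := A\<rparr>)" by (rule comm_group.solvable_comm_group)
      moreover have "order (G Mod A) = p"
        using card_rcosets_eq[OF fin A mA] mp by (simp add: order_def FactGroup_def)
      then have "comm_group (G Mod A)"
        using p normal.factorgroup_is_group[OF True] by (intro group.comm_group_prime_order) simp_all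
      then have "solvable (G Mod A)" by (rule comm_group.solvable_comm_group)
      ultimately show ?thesis by (rule normal.solvable_extension[OF True])
    next
      case False
      then show ?thesis
        using solvable_maximal_abelian[OF fin max comm False p mA] mp by blast
    qed
    then show ?thesis using max cycA card_rcosets_eq[OF fin A mA] mp by blast
  next
    case False
    \<comment> \<open>\<open>P\<close> is the Sylow \<open>p\<close>-subgroup of \<open>A\<close>;
      as \<open>p\<close> does not divide \<open>m\<close>, it is one of the whole group as
      well.\<close>
    define e where "e = p ^ multiplicity p (ord x)"
    define P where "P = {y \<in> generate G {x}. y [^] e = \<one>}"
    have e: "e dvd ord x" unfolding e_def by (rule multiplicity_dvd)
    have P_gen: "P = generate G {x [^] (ord x div e)}"
      unfolding P_def by (rule generate_roots_of_one[OF fin x e])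
    have P: "subgroup P G" unfolding P_gen using x by (intro generate_is_subgroup) auto
    have Pc: "P \<subseteq> carrier G" by (rule subgroup.subset[OF P])
    show ?thesis
    proof (cases "\<forall>g\<in>carrier G. \<forall>y\<in>P. inv g \<otimes> y \<otimes> g \<in> P")
      case True
      have "g \<otimes> y \<otimes> inv g \<in> P" if "g \<in> carrier G" "y \<in> P" for g y
        using True[rule_format, of "inv g" y] that by simp
      then have "P \<lhd> G" using P normal_inv_iff by blast
      moreover have "cyclic_group (G\<lparr>carrier := P\<rparr>)"
        unfolding P_gen using x by (intro cyclic_group_generate) simp
      moreover have "card P = p ^ multiplicity p (order G)"
      proof -
        have "multiplicity p (order G) = multiplicity p (ord x)"
          unfolding m using p False pos \<open>m > 0\<close>
          by (subst prime_elem_multiplicity_mult_distrib) (auto simp: not_dvd_imp_multiplicity_0)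
        then show ?thesis
          using card_generate_roots_of_one[OF fin x e] by (simp add: P_def e_def)
      qed
      ultimately show ?thesis using P by (auto simp: sylow_subgroup_def)
    next
      case not_normal: False
      from cyclic_subgroup_small_index[OF fin p x m m2 False P_def[unfolded e_def]] not_normal
      have mp: "m = p + 1" and N: "\<And>g. g \<in> carrier G \<Longrightarrow> (\<forall>y\<in>P. inv g \<otimes> y \<otimes> g \<in> P) \<Longrightarrow> g \<in> A"
        by (auto simp: A_def)
      have AnG: "A \<noteq> carrier G"
        using mA mp pos cardA prime_gt_0_nat[OF p] by (auto simp: order_def)
      \<comment> \<open>\<open>P\<close> is cut out of \<open>A\<close> by an equation that
        conjugation preserves, so normality would pass from \<open>A\<close> to
        \<open>P\<close>.\<close>
      have "\<not> A \<lhd> G"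
      proof
        assume An: "A \<lhd> G"
        have "inv g \<otimes> y \<otimes> g \<in> P" if g: "g \<in> carrier G" and y: "y \<in> P" for g y
        proof -
          have "y \<in> A" "y \<in> carrier G" "y [^] e = \<one>" using y Pc by (auto simp: P_def A_def)
          then have "inv g \<otimes> y \<otimes> g \<in> A" "(inv g \<otimes> y \<otimes> g) [^] e = \<one>"
            using normal.inv_op_closed1[OF An g] g by (simp_all add: conjugate_pow)
          then show ?thesis by (simp add: P_def A_def)
        qed
        then show False using not_normal by blast
      qed
      \<comment> \<open>The dichotomy is applied again inside an intermediate \<open>H\<close>, in
        which \<open>A\<close> has index \<open>k\<close> dividing \<open>m\<close>. If
        \<open>P\<close> is normal in \<open>H\<close>, then \<open>H\<close> lies in the normalizer
        of \<open>P\<close>, hence in \<open>A\<close>; otherwise \<open>k = p + 1 = m\<close> and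
        \<open>H\<close> is everything.\<close>
      have max: "maximal_subgroup G A"
        unfolding maximal_subgroup_def
      proof (intro conjI allI impI)
        fix H assume "subgroup H G \<and> A \<subseteq> H"
        then have H: "subgroup H G" and AH: "A \<subseteq> H" by auto
        interpret H: group "G\<lparr>carrier := H\<rparr>" by (rule subgroup_imp_group[OF H])
        have finH: "finite H" using fin subgroup.subset[OF H] finite_subset by blast
        have xA: "x \<in> A" unfolding A_def by (rule generate.incl) simp
        then have xH: "x \<in> H" using AH by blast
        have genH: "generate (G\<lparr>carrier := H\<rparr>) {x} = A"
          unfolding A_def using generate_consistent[OF _ H, of "{x}"] xH by simp
        have ordH: "H.ord x = ord x"
          using H.generate_pow_card[of x] genH cardA xH by simp
        obtain k where k: "card H = card A * k"
          using card_subgroup_dvd_card_subgroup[OF A H AH] by (rule dvdE)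
        have "card H dvd order G"
          using card_subgroup_dvd_card_subgroup[OF H subgroup_self subgroup.subset[OF H]]
          by (simp add: order_def)
        then have km: "k dvd m" using k mA pos cardA by (simp add: mult.commute)
        then have "k \<le> m" using \<open>m > 0\<close> by (rule dvd_imp_le)
        then have k2: "k < 2 * p" using m2 by simp
        have pk: "\<not> p dvd k" using km False dvd_trans by blast
        have oH: "order (G\<lparr>carrier := H\<rparr>) = k * H.ord x"
          using k cardA ordH by (simp add: order_def)
        \<comment> \<open>Powers, orders and generated subgroups are the same in \<open>H\<close> as
          in \<open>G\<close>, so both uses of the dichotomy concern the same
          \<open>P\<close>.\<close>
        have PH: "P = {y \<in> generate (G\<lparr>carrier := H\<rparr>) {x}.
            y [^]\<^bsub>G\<lparr>carrier := H\<rparr>\<^esub> (p ^ multiplicity p (H.ord x)) = \<one>\<^bsub>G\<lparr>carrier := H\<rparr>\<^esub>}"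
          using genH ordH by (simp add: P_def e_def A_def flip: nat_pow_consistent)
        have invH: "inv\<^bsub>G\<lparr>carrier := H\<rparr>\<^esub> g = inv g" if "g \<in> H" for g
          using m_inv_consistent[OF H that] .
        from H.cyclic_subgroup_small_index[OF _ p _ oH k2 pk PH] finH xH
        have "(\<forall>g\<in>H. \<forall>y\<in>P. inv g \<otimes> y \<otimes> g \<in> P) \<or> k = p + 1"
          using invH by auto
        then show "H = A \<or> H = carrier G"
        proof
          assume "\<forall>g\<in>H. \<forall>y\<in>P. inv g \<otimes> y \<otimes> g \<in> P"
          then have "H \<subseteq> A" using N subgroup.subset[OF H] by blast
          then show ?thesis using AH by blast
        next
          assume "k = p + 1"
          then show ?thesis
            using k mA mp card_subset_eq[OF fin subgroup.subset[OF H]] by (simp add: order_def mult.commute)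
        qed
      qed (use A AnG in auto)
      have "solvable G"
        using solvable_maximal_abelian[OF fin max comm \<open>\<not> A \<lhd> G\<close> p mA] mp by blast
      then show ?thesis using max cycA card_rcosets_eq[OF fin A mA] mp by blast
    qed
  qed
qed

theorem theorem11:
  fixes G (structure)
  assumes "group G" and "finite (carrier G)"
    and "order G > 1"
    and "q = Min (prime_factors (order G))"
    and "p = Max (prime_factors (order G))"
    and "real (psi G) \<ge> real (order G) * real (totient (order G)) / real q"
  shows "(\<exists>P. sylow_subgroup G p P \<and> P \<lhd> G \<and> cyclic_group (G\<lparr>carrier := P\<rparr>))
         \<or> (solvable G \<and> (\<exists>M. maximal_subgroup G M \<and> cyclic_group (G\<lparr>carrier := M\<rparr>)
                \<and> (card (rcosets M) = p \<or> card (rcosets M) = p + 1)))"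
proof -
  interpret group G by fact
  obtain x where x: "x \<in> carrier G" "order G < 2 * p * ord x"
    using exists_ord_index_less[OF assms(2-6)] by blast
  have "p \<in> prime_factors (order G)"
    unfolding assms(5) using assms(3) by (intro Max_in) (auto simp: prime_factorization_empty_iff)
  then have "prime p" by (rule in_prime_factors_imp_prime)
  then show ?thesis
    using cyclic_subgroup_index_less_twice_prime[OF assms(2) _ x] by blast
qed

end
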